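(* Let $\mathbf{k}$ be a unitary commutative ring and $\Omega$ a nonempty set. (a) Let $(R,\{\prec_\omega,\succ_\omega\mid\omega\in\Omega\})$ be a matching dendriform algebra and define $$x\bullet_\omega y:=x\succ_\omega y+x\prec_\omega y,\qquad x,y\in R,\ \omega\in\Omega .$$ Then $(R,\{\bullet_\omega\mid\omega\in\Omega\})$ is a compatible associative algebra. (b) Let $(R,\{\prec_\omega,\succ_\omega,\cdot_\omega\mid\omega\in\Omega\})$ be a matching tridendriform algebra and define $$x\bullet_\omega y:=x\succ_\omega y+x\prec_\omega y+x\cdot_\omega y,\qquad x,y\in R,\ \omega\in\Omega .$$ Then $(R,\{\bullet_\omega\mid\omega\in\Omega\})$ is a compatible associative algebra.
   Context: All modules are over $\mathbf{k}$ and all binary operations are $\mathbf{k}$-bilinear. A compatible (multiple) associative algebra is a module $A$ with binary operations $\{\bullet_\omega\mid\omega\in\Omega\}$ such that $$(x\bullet_\alpha y)\bullet_\beta z+(x\bullet_\beta y)\bullet_\alpha z=x\bullet_\alpha(y\bullet_\beta z)+x\bullet_\beta(y\bullet_\alpha z)\quad\text{for all }x,y,z\in A,\ \alpha,\beta\in\Omega .$$ A matching dendriform algebra is a module $D$ with binary operations $\{\prec_\omega,\succ_\omega\mid\omega\in\Omega\}$ such that for all $x,y,z\in D$ and $\alpha,\beta\in\Omega$: $$(x\prec_\alpha y)\prec_\beta z=x\prec_\alpha(y\prec_\beta z)+x\prec_\beta(y\succ_\alpha z),$$ $$(x\succ_\alpha y)\prec_\beta z=x\succ_\alpha(y\prec_\beta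 z),$$ $$(x\prec_\beta y)\succ_\alpha z+(x\succ_\alpha y)\succ_\beta z=x\succ_\alpha(y\succ_\beta z).$$ A matching tridendriform algebra is a module $T$ with binary operations $\{\prec_\omega,\succ_\omega,\cdot_\omega\mid\omega\in\Omega\}$ such that for all $x,y,z\in T$ and $\alpha,\beta\in\Omega$: $$(x\prec_\alpha y)\prec_\beta z=x\prec_\alpha(y\prec_\beta z)+x\prec_\beta(y\succ_\alpha z)+x\prec_\alpha(y\cdot_\beta z),$$ $$(x\succ_\alpha y)\prec_\beta z=x\succ_\alpha(y\prec_\beta z),$$ $$x\succ_\alpha(y\succ_\beta z)=(x\prec_\beta y)\succ_\alpha z+(x\succ_\alpha y)\succ_\beta z+(x\cdot_\beta y)\succ_\alpha z,$$ $$(x\succ_\alpha y)\cdot_\beta z=x\succ_\alpha(y\cdot_\beta z),$$ $$(x\prec_\alpha y)\cdot_\beta z=x\cdot_\beta(y\succ_\alpha z),$$ $$(x\cdot_\alpha y)\prec_\beta z=x\cdot_\alpha(y\prec_\beta z),$$ $$(x\cdot_\alpha y)\cdot_\beta z=x\cdot_\alpha(y\cdot_\beta z).$$ *)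

theory Defs
  imports "HOL-Algebra.Module"
begin

text \<open>
  Modules are those of \<^theory>\<open>HOL-Algebra.Module\<close>, with base ring \<^term>\<open>K\<close> and module \<^term>\<open>M\<close>;
  the ring-multiplication fields of the record \<^term>\<open>M\<close> play no role. A family of binary operations
  indexed by a set \<^term>\<open>\<Omega>\<close> is a function of the index followed by the two arguments; its values at
  indices outside \<^term>\<open>\<Omega>\<close> or at arguments outside the carrier are irrelevant.
\<close>

definition bilinear_op ::
  "('k, 'm) ring_scheme \<Rightarrow> ('k, 'a, 'n) module_scheme \<Rightarrow> ('a \<Rightarrow> 'a \<Rightarrow> 'a) \<Rightarrow> bool"
  where "bilinear_op K M f \<longleftrightarrow>
    (\<forall>x\<in>carrier M. \<forall>y\<in>carrier M. f x y \<in> carrier M) \<and>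
    (\<forall>x\<in>carrier M. \<forall>y\<in>carrier M. \<forall>z\<in>carrier M.
        f (x \<oplus>\<^bsub>M\<^esub> y) z = f x z \<oplus>\<^bsub>M\<^esub> f y z \<and>
        f x (y \<oplus>\<^bsub>M\<^esub> z) = f x y \<oplus>\<^bsub>M\<^esub> f x z) \<and>
    (\<forall>c\<in>carrier K. \<forall>x\<in>carrier M. \<forall>y\<in>carrier M.
        f (c \<odot>\<^bsub>M\<^esub> x) y = c \<odot>\<^bsub>M\<^esub> f x y \<and>
        f x (c \<odot>\<^bsub>M\<^esub> y) = c \<odot>\<^bsub>M\<^esub> f x y)"

locale compatible_associative_algebra = module K M
  for K :: "('k, 'm) ring_scheme" and M :: "('k, 'a, 'n) module_scheme" (structure) +
  fixes \<Omega> :: "'w set" and bullet :: "'w \<Rightarrow> 'a \<Rightarrow> 'a \<Rightarrow> 'a"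
  assumes bullet_bilinear: "\<omega> \<in> \<Omega> \<Longrightarrow> bilinear_op K M (bullet \<omega>)"
    and compatible:
      "\<lbrakk>\<alpha> \<in> \<Omega>; \<beta> \<in> \<Omega>; x \<in> carrier M; y \<in> carrier M; z \<in> carrier M\<rbrakk> \<Longrightarrow>
        bullet \<beta> (bullet \<alpha> x y) z \<oplus> bullet \<alpha> (bullet \<beta> x y) z
        = bullet \<alpha> x (bullet \<beta> y z) \<oplus> bullet \<beta> x (bullet \<alpha> y z)"

locale matching_dendriform_algebra = module K M
  for K :: "('k, 'm) ring_scheme" and M :: "('k, 'a, 'n) module_scheme" (structure) +
  fixes \<Omega> :: "'w set" and prec succ :: "'w \<Rightarrow> 'a \<Rightarrow> 'a \<Rightarrow> 'a"
  assumes prec_bilinear: "\<omega> \<in> \<Omega> \<Longrightarrow> bilinear_op K M (prec \<omega>)"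
    and succ_bilinear: "\<omega> \<in> \<Omega> \<Longrightarrow> bilinear_op K M (succ \<omega>)"
    and prec_prec:
      "\<lbrakk>\<alpha> \<in> \<Omega>; \<beta> \<in> \<Omega>; x \<in> carrier M; y \<in> carrier M; z \<in> carrier M\<rbrakk> \<Longrightarrow>
        prec \<beta> (prec \<alpha> x y) z = prec \<alpha> x (prec \<beta> y z) \<oplus> prec \<beta> x (succ \<alpha> y z)"
    and succ_prec:
      "\<lbrakk>\<alpha> \<in> \<Omega>; \<beta> \<in> \<Omega>; x \<in> carrier M; y \<in> carrier M; z \<in> carrier M\<rbrakk> \<Longrightarrow>
        prec \<beta> (succ \<alpha> x y) z = succ \<alpha> x (prec \<beta> y z)"
    and succ_succ:
      "\<lbrakk>\<alpha> \<in> \<Omega>; \<beta> \<in> \<Omega>; x \<in> carrier M; y \<in> carrier M; z \<in> carrier M\<rbrakk> \<Longrightarrow>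
        succ \<alpha> (prec \<beta> x y) z \<oplus> succ \<beta> (succ \<alpha> x y) z = succ \<alpha> x (succ \<beta> y z)"

locale matching_tridendriform_algebra = module K M
  for K :: "('k, 'm) ring_scheme" and M :: "('k, 'a, 'n) module_scheme" (structure) +
  fixes \<Omega> :: "'w set" and prec succ dot :: "'w \<Rightarrow> 'a \<Rightarrow> 'a \<Rightarrow> 'a"
  assumes prec_bilinear: "\<omega> \<in> \<Omega> \<Longrightarrow> bilinear_op K M (prec \<omega>)"
    and succ_bilinear: "\<omega> \<in> \<Omega> \<Longrightarrow> bilinear_op K M (succ \<omega>)"
    and dot_bilinear: "\<omega> \<in> \<Omega> \<Longrightarrow> bilinear_op K M (dot \<omega>)"
    and prec_prec:
      "\<lbrakk>\<alpha> \<in> \<Omega>; \<beta> \<in> \<Omega>; x \<in> carrier M; y \<in> carrier M; z \<in> carrier M\<rbrakk> \<Longrightarrow>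
        prec \<beta> (prec \<alpha> x y) z
        = prec \<alpha> x (prec \<beta> y z) \<oplus> prec \<beta> x (succ \<alpha> y z) \<oplus> prec \<alpha> x (dot \<beta> y z)"
    and succ_prec:
      "\<lbrakk>\<alpha> \<in> \<Omega>; \<beta> \<in> \<Omega>; x \<in> carrier M; y \<in> carrier M; z \<in> carrier M\<rbrakk> \<Longrightarrow>
        prec \<beta> (succ \<alpha> x y) z = succ \<alpha> x (prec \<beta> y z)"
    and succ_succ:
      "\<lbrakk>\<alpha> \<in> \<Omega>; \<beta> \<in> \<Omega>; x \<in> carrier M; y \<in> carrier M; z \<in> carrier M\<rbrakk> \<Longrightarrow>
        succ \<alpha> x (succ \<beta> y z)
        = succ \<alpha> (prec \<beta> x y) z \<oplus> succ \<beta> (succ \<alpha> x y) z \<oplus> succ \<alpha> (dot \<beta> x y) z"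
    and succ_dot:
      "\<lbrakk>\<alpha> \<in> \<Omega>; \<beta> \<in> \<Omega>; x \<in> carrier M; y \<in> carrier M; z \<in> carrier M\<rbrakk> \<Longrightarrow>
        dot \<beta> (succ \<alpha> x y) z = succ \<alpha> x (dot \<beta> y z)"
    and prec_dot:
      "\<lbrakk>\<alpha> \<in> \<Omega>; \<beta> \<in> \<Omega>; x \<in> carrier M; y \<in> carrier M; z \<in> carrier M\<rbrakk> \<Longrightarrow>
        dot \<beta> (prec \<alpha> x y) z = dot \<beta> x (succ \<alpha> y z)"
    and dot_prec:
      "\<lbrakk>\<alpha> \<in> \<Omega>; \<beta> \<in> \<Omega>; x \<in> carrier M; y \<in> carrier M; z \<in> carrier M\<rbrakk> \<Longrightarrow>
        prec \<beta> (dot \<alpha> x y) z = dot \<alpha> x (prec \<beta> y z)"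
    and dot_dot:
      "\<lbrakk>\<alpha> \<in> \<Omega>; \<beta> \<in> \<Omega>; x \<in> carrier M; y \<in> carrier M; z \<in> carrier M\<rbrakk> \<Longrightarrow>
        dot \<beta> (dot \<alpha> x y) z = dot \<alpha> x (dot \<beta> y z)"

end

theory Submission
  imports Defs
begin

text \<open>Expand both triple products by bilinearity and apply the axioms to each monomial. For
  one ordered pair \<open>(\<alpha>, \<beta>)\<close> the two sides need not agree: the left one
  yields \<open>prec \<beta> x (succ \<alpha> y z)\<close> and
  \<open>succ \<beta> (prec \<alpha> x y) z\<close>, the right one the same terms with \<alpha> and
  \<beta> exchanged. All other terms agree, so adding the identity for the exchanged pair restores
  equality. In the tridendriform case the terms \<open>dot \<beta> x (succ \<alpha> y z)\<close> and
  \<open>succ \<beta> (dot \<alpha> x y) z\<close> are exchanged in the same way.\<close>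

lemma bilinear_opD:
  assumes "bilinear_op K M f"
  shows bilinear_op_closed: "\<lbrakk>x \<in> carrier M; y \<in> carrier M\<rbrakk> \<Longrightarrow> f x y \<in> carrier M"
    and bilinear_op_add_left:
      "\<lbrakk>x \<in> carrier M; y \<in> carrier M; z \<in> carrier M\<rbrakk> \<Longrightarrow>
        f (x \<oplus>\<^bsub>M\<^esub> y) z = f x z \<oplus>\<^bsub>M\<^esub> f y z"
    and bilinear_op_add_right:
      "\<lbrakk>x \<in> carrier M; y \<in> carrier M; z \<in> carrier M\<rbrakk> \<Longrightarrow>
        f x (y \<oplus>\<^bsub>M\<^esub> z) = f x y \<oplus>\<^bsub>M\<^esub> f x z"
    and bilinear_op_smult_left:
      "\<lbrakk>c \<in> carrier K; x \<in> carrier M; y \<in> carrier M\<rbrakk> \<Longrightarrow> f (c \<odot>\<^bsub>M\<^esub> x) y = c \<odot>\<^bsub>M\<^esub> f x y"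
    and bilinear_op_smult_right:
      "\<lbrakk>c \<in> carrier K; x \<in> carrier M; y \<in> carrier M\<rbrakk> \<Longrightarrow> f x (c \<odot>\<^bsub>M\<^esub> y) = c \<odot>\<^bsub>M\<^esub> f x y"
  using assms unfolding bilinear_op_def by auto

lemma (in module) bilinear_op_add:
  assumes f: "bilinear_op R M f" and g: "bilinear_op R M g"
  shows "bilinear_op R M (\<lambda>x y. f x y \<oplus>\<^bsub>M\<^esub> g x y)"
  unfolding bilinear_op_def
  by (simp add: bilinear_opD[OF f] bilinear_opD[OF g] M.a_ac smult_r_distr)

context matching_dendriform_algebra
begin

text \<open>Closure accompanies additivity because the AC laws of the carrier-based module are
  conditional on membership of every summand.\<close>

lemmas op_simps =
  bilinear_opD(1-3)[OF prec_bilinear] bilinear_opD(1-3)[OF succ_bilinear]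

lemma compatible_associative_algebra_sum:
  "compatible_associative_algebra K M \<Omega> (\<lambda>\<omega> x y. succ \<omega> x y \<oplus> prec \<omega> x y)"
proof unfold_locales
  show "bilinear_op K M (\<lambda>x y. succ \<omega> x y \<oplus> prec \<omega> x y)" if "\<omega> \<in> \<Omega>" for \<omega>
    using that by (intro bilinear_op_add prec_bilinear succ_bilinear)
\<comment> \<open>\<open>succ_succ\<close> is reversed so that every axiom rewrites a single
  monomial. Normal forms are left-nested exactly when the outer operation is \<open>succ\<close> and
  they come from \<open>succ (prec x y) z\<close> or \<open>succ (succ x y) z\<close>; then only the
  order of summands remains.\<close>
qed (simp add: op_simps prec_prec succ_prec succ_succ[symmetric] M.a_ac)

end

context matching_tridendriform_algebra
begin

lemmas op_simps =
  bilinear_opD(1-3)[OF prec_bilinear] bilinear_opD(1-3)[OF succ_bilinear]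
  bilinear_opD(1-3)[OF dot_bilinear]

lemma compatible_associative_algebra_sum:
  "compatible_associative_algebra K M \<Omega> (\<lambda>\<omega> x y. succ \<omega> x y \<oplus> prec \<omega> x y \<oplus> dot \<omega> x y)"
proof unfold_locales
  show "bilinear_op K M (\<lambda>x y. succ \<omega> x y \<oplus> prec \<omega> x y \<oplus> dot \<omega> x y)" if "\<omega> \<in> \<Omega>" for \<omega>
    using that by (intro bilinear_op_add prec_bilinear succ_bilinear dot_bilinear)
\<comment> \<open>Here \<open>succ_succ\<close> already expands a single monomial. Left nesting
  under an outer \<open>prec\<close> or \<open>dot\<close> is moved to the right, right nesting of
  two \<open>succ\<close> to the left, so both sides reach the same summands up to order.\<close>
qed (simp add: op_simps prec_prec succ_prec succ_succ succ_dot prec_dot dot_prec dot_dot M.a_ac)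

end

theorem theorem3p11:
  fixes K :: "('k, 'm) ring_scheme" and \<Omega> :: "'w set"
  assumes "cring K" and "\<Omega> \<noteq> {}"
  shows
    "(\<forall>(R :: ('k, 'a, 'n) module_scheme) prec succ.
        matching_dendriform_algebra K R \<Omega> prec succ \<longrightarrow>
        compatible_associative_algebra K R \<Omega>
          (\<lambda>\<omega> x y. succ \<omega> x y \<oplus>\<^bsub>R\<^esub> prec \<omega> x y)) \<and>
     (\<forall>(R :: ('k, 'a, 'n) module_scheme) prec succ dot.
        matching_tridendriform_algebra K R \<Omega> prec succ dot \<longrightarrow>
        compatible_associative_algebra K R \<Omega>
          (\<lambda>\<omega> x y. succ \<omega> x y \<oplus>\<^bsub>R\<^esub> prec \<omega> x y \<oplus>\<^bsub>R\<^esub> dot \<omega> x y))"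
  by (intro conjI allI impI matching_dendriform_algebra.compatible_associative_algebra_sum
      matching_tridendriform_algebra.compatible_associative_algebra_sum)

end
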